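(* Let $\preceq$ be an order on $\mathbb{T}$ compatible with arithmetic operations, satisfying the weak law of trichotomy (WLT) and having positive $0$-symmetric numbers. Then $\preceq$ induces a fuzzy absolute value $|\cdot|_{\preceq}$, which satisfies, for arbitrary elements $\alpha,\beta,\gamma\in\mathbb{T}$: (i) $|\alpha|_{\preceq}=\alpha$ if and only if $0\preceq\alpha$; and $|\alpha|_{\preceq}=0$ if and only if $\alpha=0$; (ii) $|t\alpha|_{\preceq}=|t|\,|\alpha|_{\preceq}$ for all $t\in\mathbb{R}$, where $|t|$ is the usual absolute value of the real number $t$; and $|\cdot|_{\preceq}$ extends the real absolute value (real numbers being identified with scalars in $\mathbb{T}$); (iii) $|\alpha+\beta|_{\preceq}\preceq|\alpha|_{\preceq}+|\beta|_{\preceq}$; (iv) $|\alpha-\gamma|_{\preceq}\preceq|\alpha-\beta|_{\preceq}+|\beta-\gamma|_{\preceq}$; (v) $\big||\alpha|_{\preceq}-|\beta|_{\preceq}\big|_{\preceq}\preceq|\alpha-\beta|_{\preceq}$.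
   Context: Triangular fuzzy numbers: $\mathbb{T}=\{(a_1,a,a_2)\in\mathbb{R}^3: a_1\le a\le a_2\}$. Each $t\in\mathbb{R}$ is identified with the scalar $(t,t,t)\in\mathbb{T}$; in particular $0=(0,0,0)$. Operations: $(a_1,a,a_2)+(b_1,b,b_2)=(a_1+b_1,a+b,a_2+b_2)$; for $t\in\mathbb{R}$, $t(a_1,a,a_2)=(ta_1,ta,ta_2)$ if $t\ge0$ and $(ta_2,ta,ta_1)$ if $t<0$; $-\alpha=(-1)\alpha$, $\alpha-\beta=\alpha+(-1)\beta$. An order on $\mathbb{T}$ means a total order $\preceq$ (total, reflexive, antisymmetric, transitive); $\alpha\prec\beta$ means $\alpha\preceq\beta$ and $\alpha\ne\beta$. $I_0=\{(-t,0,t): t\in\mathbb{R},\ t>0\}$ is the set of nonzero $0$-symmetric numbers, i.e. of $\alpha\neq 0$ with $\alpha=-\alpha$. The order has positive $0$-symmetric numbers if there is $\alpha\in I_0$ with $0\prec\alpha$. Compatibility with arithmetic operations: $\alpha\preceq\beta$ implies $\alpha+\gamma\preceq\beta+\gamma$ for all $\gamma\in\mathbb{T}$, and $t\alpha\preceq t\beta$ for all real $t\ge0$. WLT: for every $\alpha\in\mathbb{T}\setminus I_0$, exactly one of the following holds: $\alpha=0$, $0\prec\alpha$, $0\prec-\alpha$. For a total order $\preceq$, $|\alpha|_{\preceq}=\max_{\preceq}\{\alpha,-\alpha\}$. The order $\preceq$ induces a fuzzy absolute value if for all $\alpha,\beta,\gamma\in\mathbb{T}$, $t\in\mathbb{R}$: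 $|\alpha|_{\preceq}\succeq0$; $|t\alpha|_{\preceq}=|t||\alpha|_{\preceq}$; $|\alpha+\beta|_{\preceq}\preceq|\alpha|_{\preceq}+|\beta|_{\preceq}$; and $|\alpha-\gamma|_{\preceq}\preceq|\alpha-\beta|_{\preceq}+|\beta-\gamma|_{\preceq}$.
   Formalization: In (ii), that |·| extends the real absolute value is stated only for orders with 0 ⪯ 1; without this it fails, e.g. for the lexicographic order by (−a, −(a₁+a₂), a₂−a₁), where |1| = −1. By (i) the condition is necessary. *)

theory Defs
  imports Complex_Main
begin

typedef tri_fuzzy = "{(a1, a, a2). a1 \<le> a \<and> a \<le> a2} :: (real \<times> real \<times> real) set"
  morphisms coords Abs_tri_fuzzy
  by (rule exI[of _ "(0, 0, 0)"]) simp

setup_lifting type_definition_tri_fuzzy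

lift_definition scalar :: "real \<Rightarrow> tri_fuzzy" is "\<lambda>t. (t, t, t)"
  by simp

(* A total order compatible with the arithmetic operations may restrict to the
   usual order of the reals on scalars or to the reverse one: scaling is only
   required to be monotone, so 0 below scalar 1 is a separate condition. *)

(* There are no additive inverses: uminus is multiplication by -1, so that
   \<alpha> - \<alpha> need not be 0 and the group classes are not available. *)
instantiation tri_fuzzy :: "{comm_monoid_add, scaleR, uminus, minus}"
begin

definition zero_tri_fuzzy :: tri_fuzzy
  where "0 = scalar 0"

lift_definition plus_tri_fuzzy :: "tri_fuzzy \<Rightarrow> tri_fuzzy \<Rightarrow> tri_fuzzy"
  is "\<lambda>(a1, a, a2) (b1, b, b2). (a1 + b1, a + b, a2 + b2)"
  by auto

lift_definition scaleR_tri_fuzzy :: "real \<Rightarrow> tri_fuzzy \<Rightarrow> tri_fuzzy"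
  is "\<lambda>t (a1, a, a2). if 0 \<le> t then (t * a1, t * a, t * a2) else (t * a2, t * a, t * a1)"
  by (auto split: if_splits intro: mult_left_mono mult_left_mono_neg)

definition uminus_tri_fuzzy :: "tri_fuzzy \<Rightarrow> tri_fuzzy"
  where "- (\<alpha> :: tri_fuzzy) = (-1) *\<^sub>R \<alpha>"

definition minus_tri_fuzzy :: "tri_fuzzy \<Rightarrow> tri_fuzzy \<Rightarrow> tri_fuzzy"
  where "\<alpha> - \<beta> = (\<alpha> :: tri_fuzzy) + (-1) *\<^sub>R \<beta>"

instance
proof
  fix a b c :: tri_fuzzy
  show "a + b + c = a + (b + c)" by transfer auto
  show "a + b = b + a" by transfer auto
  show "0 + a = a" unfolding zero_tri_fuzzy_def by transfer auto
qed

end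

definition zero_symmetric :: "tri_fuzzy set"
  where "zero_symmetric = {\<alpha>. \<exists>t>0. coords \<alpha> = (- t, 0, t)}"

lemma zero_symmetric_iff: "\<alpha> \<in> zero_symmetric \<longleftrightarrow> \<alpha> \<noteq> 0 \<and> \<alpha> = - \<alpha>"
  unfolding zero_symmetric_def zero_tri_fuzzy_def uminus_tri_fuzzy_def mem_Collect_eq
  by transfer auto

definition total_order :: "('a \<Rightarrow> 'a \<Rightarrow> bool) \<Rightarrow> bool"
  where "total_order le \<longleftrightarrow> totalp le \<and> reflp le \<and> antisymp le \<and> transp le"

definition strict_part :: "('a \<Rightarrow> 'a \<Rightarrow> bool) \<Rightarrow> 'a \<Rightarrow> 'a \<Rightarrow> bool"
  where "strict_part le \<alpha> \<beta> \<longleftrightarrow> le \<alpha> \<beta> \<and> \<alpha> \<noteq> \<beta>"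

definition has_positive_zero_symmetric :: "(tri_fuzzy \<Rightarrow> tri_fuzzy \<Rightarrow> bool) \<Rightarrow> bool"
  where "has_positive_zero_symmetric le \<longleftrightarrow> (\<exists>\<alpha>\<in>zero_symmetric. strict_part le 0 \<alpha>)"

definition arith_compatible :: "(tri_fuzzy \<Rightarrow> tri_fuzzy \<Rightarrow> bool) \<Rightarrow> bool"
  where "arith_compatible le \<longleftrightarrow>
    (\<forall>\<alpha> \<beta>. le \<alpha> \<beta> \<longrightarrow>
      (\<forall>\<gamma>. le (\<alpha> + \<gamma>) (\<beta> + \<gamma>)) \<and> (\<forall>t\<ge>0. le (t *\<^sub>R \<alpha>) (t *\<^sub>R \<beta>)))"

definition weak_trichotomy :: "(tri_fuzzy \<Rightarrow> tri_fuzzy \<Rightarrow> bool) \<Rightarrow> bool"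
  where "weak_trichotomy le \<longleftrightarrow>
    (\<forall>\<alpha>. \<alpha> \<notin> zero_symmetric \<longrightarrow>
      (\<alpha> = 0 \<and> \<not> strict_part le 0 \<alpha> \<and> \<not> strict_part le 0 (- \<alpha>)) \<or>
      (\<alpha> \<noteq> 0 \<and> strict_part le 0 \<alpha> \<and> \<not> strict_part le 0 (- \<alpha>)) \<or>
      (\<alpha> \<noteq> 0 \<and> \<not> strict_part le 0 \<alpha> \<and> strict_part le 0 (- \<alpha>)))"

(* ord.max le is the library maximum with the order relation as a parameter. *)
definition fuzzy_abs :: "(tri_fuzzy \<Rightarrow> tri_fuzzy \<Rightarrow> bool) \<Rightarrow> tri_fuzzy \<Rightarrow> tri_fuzzy"
  where "fuzzy_abs le \<alpha> = ord.max le \<alpha> (- \<alpha>)"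

definition induces_fuzzy_abs :: "(tri_fuzzy \<Rightarrow> tri_fuzzy \<Rightarrow> bool) \<Rightarrow> bool"
  where "induces_fuzzy_abs le \<longleftrightarrow>
    (\<forall>\<alpha> \<beta> \<gamma> t.
      le 0 (fuzzy_abs le \<alpha>) \<and>
      fuzzy_abs le (t *\<^sub>R \<alpha>) = \<bar>t\<bar> *\<^sub>R fuzzy_abs le \<alpha> \<and>
      le (fuzzy_abs le (\<alpha> + \<beta>)) (fuzzy_abs le \<alpha> + fuzzy_abs le \<beta>) \<and>
      le (fuzzy_abs le (\<alpha> - \<gamma>)) (fuzzy_abs le (\<alpha> - \<beta>) + fuzzy_abs le (\<beta> - \<gamma>)))"

end

theory Submission
  imports Defs
begin

text \<open>
  Positive scaling moves all \<open>0\<close>-symmetric numbers above \<open>0\<close>, so \<open>\<beta> - \<beta>\<close>, although not \<open>0\<close>,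
  is always nonnegative. Together with trichotomy this makes the absolute value of \<open>\<alpha>\<close> the
  nonnegative one among \<open>\<alpha>\<close> and \<open>- \<alpha>\<close>, whence homogeneity and subadditivity. The
  remaining inequalities absorb the defect \<open>\<beta> - \<beta>\<close>: adding it only enlarges an element, it
  commutes with the absolute value, and addition is order-cancellative because it is
  cancellative and the order is total.
\<close>

lemma scalar_eq_scaleR: "scalar t = t *\<^sub>R scalar 1"
  by transfer auto

lemma tri_scaleR_zero [simp]: "t *\<^sub>R (0 :: tri_fuzzy) = 0"
  unfolding zero_tri_fuzzy_def by transfer auto

lemma tri_uminus_zero [simp]: "- (0 :: tri_fuzzy) = 0"
  unfolding uminus_tri_fuzzy_def by simp

lemma tri_uminus_uminus [simp]: "- (- \<alpha>) = (\<alpha> :: tri_fuzzy)"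
  unfolding uminus_tri_fuzzy_def by transfer auto

lemma tri_scaleR_uminus: "t *\<^sub>R (- \<alpha>) = (- t) *\<^sub>R (\<alpha> :: tri_fuzzy)"
  unfolding uminus_tri_fuzzy_def by transfer (auto split: if_splits)

lemma tri_uminus_scaleR: "- (t *\<^sub>R \<alpha>) = (- t) *\<^sub>R (\<alpha> :: tri_fuzzy)"
  unfolding uminus_tri_fuzzy_def by transfer (auto split: if_splits)

lemma tri_uminus_add: "- (\<alpha> + \<beta>) = - \<alpha> + - (\<beta> :: tri_fuzzy)"
  unfolding uminus_tri_fuzzy_def by transfer auto

lemma tri_minus_eq: "\<alpha> - \<beta> = \<alpha> + - (\<beta> :: tri_fuzzy)"
  unfolding uminus_tri_fuzzy_def minus_tri_fuzzy_def ..

lemma tri_uminus_minus: "- (\<alpha> - \<beta>) = \<beta> - (\<alpha> :: tri_fuzzy)"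
  by (simp add: tri_minus_eq tri_uminus_add add.commute)

text \<open>Addition is coordinatewise in the reals, so it cancels even without additive
  inverses.\<close>

lemma tri_add_right_cancel: "\<alpha> + \<gamma> = \<beta> + \<gamma> \<longleftrightarrow> \<alpha> = (\<beta> :: tri_fuzzy)"
  by transfer auto

text \<open>The \<open>0\<close>-symmetric numbers form a single open ray, so under a compatible
  order they all share one sign.\<close>

lemma zero_symmetric_scaleR:
  assumes "\<alpha> \<in> zero_symmetric" "\<beta> \<in> zero_symmetric"
  obtains t where "t > 0" "\<beta> = t *\<^sub>R \<alpha>"
proof -
  from assms obtain r s where rs: "r > 0" "s > 0" "coords \<alpha> = (- r, 0, r)" "coords \<beta> = (- s, 0, s)"
    unfolding zero_symmetric_def by blast
  then have "coords \<beta> = coords ((s / r) *\<^sub>R \<alpha>)"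
    by (simp add: scaleR_tri_fuzzy.rep_eq)
  with rs show thesis
    by (metis that coords_inject divide_pos_pos)
qed

locale compatible_fuzzy_order =
  fixes le :: "tri_fuzzy \<Rightarrow> tri_fuzzy \<Rightarrow> bool"  (infix "\<preceq>" 50)
  assumes total_order: "total_order (\<preceq>)"
    and arith_compatible: "arith_compatible (\<preceq>)"
    and weak_trichotomy: "weak_trichotomy (\<preceq>)"
    and has_positive_zero_symmetric: "has_positive_zero_symmetric (\<preceq>)"
begin

abbreviation absolute_value :: "tri_fuzzy \<Rightarrow> tri_fuzzy"  ("\<bar>_\<bar>\<^sub>F")
  where "\<bar>\<alpha>\<bar>\<^sub>F \<equiv> fuzzy_abs (\<preceq>) \<alpha>"

lemma le_refl [simp]: "\<alpha> \<preceq> \<alpha>"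
  using total_order unfolding total_order_def by (blast dest: reflpD)

lemma le_antisym: "\<alpha> \<preceq> \<beta> \<Longrightarrow> \<beta> \<preceq> \<alpha> \<Longrightarrow> \<alpha> = \<beta>"
  using total_order unfolding total_order_def by (blast dest: antisympD)

lemma le_trans [trans]: "\<alpha> \<preceq> \<beta> \<Longrightarrow> \<beta> \<preceq> \<gamma> \<Longrightarrow> \<alpha> \<preceq> \<gamma>"
  using total_order unfolding total_order_def by (blast dest: transpD)

lemma le_total: "\<alpha> \<preceq> \<beta> \<or> \<beta> \<preceq> \<alpha>"
  using total_order le_refl unfolding total_order_def by (metis totalpD)

lemma le_add_right: "\<alpha> \<preceq> \<beta> \<Longrightarrow> \<alpha> + \<gamma> \<preceq> \<beta> + \<gamma>"
  and le_scaleR: "\<alpha> \<preceq> \<beta> \<Longrightarrow> 0 \<le> t \<Longrightarrow> t *\<^sub>R \<alpha> \<preceq> t *\<^sub>R \<beta>"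
  using arith_compatible unfolding arith_compatible_def by blast+

lemma le_add_mono: "\<alpha> \<preceq> \<beta> \<Longrightarrow> \<gamma> \<preceq> \<delta> \<Longrightarrow> \<alpha> + \<gamma> \<preceq> \<beta> + \<delta>"
  using le_add_right[of \<alpha> \<beta> \<gamma>] le_add_right[of \<gamma> \<delta> \<beta>] le_trans by (simp add: add.commute)

text \<open>Were \<beta> strictly below \<alpha>, adding \<gamma> would give the reverse inequality
  too, and antisymmetry with cancellation would force \<alpha> = \<beta>.\<close>

lemma le_add_right_cancel: "\<alpha> + \<gamma> \<preceq> \<beta> + \<gamma> \<Longrightarrow> \<alpha> \<preceq> \<beta>"
  by (metis le_total le_add_right le_antisym tri_add_right_cancel)

lemma le_add_nonneg: "0 \<preceq> \<sigma> \<Longrightarrow> \<alpha> \<preceq> \<alpha> + \<sigma>"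
  using le_add_mono[of \<alpha> \<alpha> 0 \<sigma>] by simp

lemma nonneg_scaleR: "0 \<preceq> \<alpha> \<Longrightarrow> 0 \<le> t \<Longrightarrow> 0 \<preceq> t *\<^sub>R \<alpha>"
  using le_scaleR[of 0 \<alpha> t] by simp

text \<open>A nonzero fixed point of negation is \<open>0\<close>-symmetric, hence a positive
  multiple of the one assumed to be positive.\<close>

lemma nonneg_if_uminus_eq:
  assumes "- \<sigma> = \<sigma>"
  shows "0 \<preceq> \<sigma>"
proof (cases "\<sigma> = 0")
  case False
  then have "\<sigma> \<in> zero_symmetric"
    using assms by (simp add: zero_symmetric_iff)
  moreover obtain \<alpha> where "\<alpha> \<in> zero_symmetric" "0 \<preceq> \<alpha>"
    using has_positive_zero_symmetric
    unfolding has_positive_zero_symmetric_def strict_part_def by blast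
  ultimately show ?thesis
    by (metis zero_symmetric_scaleR nonneg_scaleR less_imp_le)
qed simp

lemma nonneg_minus_self: "0 \<preceq> \<beta> - \<beta>"
  by (rule nonneg_if_uminus_eq) (rule tri_uminus_minus)

text \<open>Trichotomy is silent on \<open>0\<close>-symmetric numbers; there
  \<open>nonneg_if_uminus_eq\<close> takes over.\<close>

lemma nonneg_or_uminus_nonneg: "0 \<preceq> \<alpha> \<or> 0 \<preceq> - \<alpha>"
  using weak_trichotomy nonneg_if_uminus_eq[of \<alpha>] le_refl
  unfolding weak_trichotomy_def strict_part_def by (metis zero_symmetric_iff)

text \<open>Off the \<open>0\<close>-symmetric numbers trichotomy forbids both strict signs at once,
  which leaves only \<alpha> = 0.\<close>

lemma nonneg_and_uminus_nonneg: "0 \<preceq> \<alpha> \<Longrightarrow> 0 \<preceq> - \<alpha> \<Longrightarrow> - \<alpha> = \<alpha>"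
  using weak_trichotomy unfolding weak_trichotomy_def strict_part_def
  by (metis zero_symmetric_iff tri_uminus_uminus tri_uminus_zero)

lemma abs_eq_max: "\<bar>\<alpha>\<bar>\<^sub>F = (if \<alpha> \<preceq> - \<alpha> then - \<alpha> else \<alpha>)"
  unfolding fuzzy_abs_def ord.max_def ..

lemma abs_cases: "\<bar>\<alpha>\<bar>\<^sub>F = \<alpha> \<or> \<bar>\<alpha>\<bar>\<^sub>F = - \<alpha>"
  by (simp add: abs_eq_max)

lemma abs_uminus [simp]: "\<bar>- \<alpha>\<bar>\<^sub>F = \<bar>\<alpha>\<bar>\<^sub>F"
  using le_antisym le_total by (auto simp: abs_eq_max)

lemma le_abs: "\<alpha> \<preceq> \<bar>\<alpha>\<bar>\<^sub>F"
  by (simp add: abs_eq_max)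

lemma uminus_le_abs: "- \<alpha> \<preceq> \<bar>\<alpha>\<bar>\<^sub>F"
  using le_abs[of "- \<alpha>"] by simp

lemma abs_leI: "\<alpha> \<preceq> \<beta> \<Longrightarrow> - \<alpha> \<preceq> \<beta> \<Longrightarrow> \<bar>\<alpha>\<bar>\<^sub>F \<preceq> \<beta>"
  using abs_cases[of \<alpha>] by auto

lemma abs_nonneg: "0 \<preceq> \<bar>\<alpha>\<bar>\<^sub>F"
  using nonneg_or_uminus_nonneg le_trans le_abs uminus_le_abs by blast

text \<open>If \<alpha> is nonnegative but the maximum is \<open>- \<alpha>\<close>, then
  \<open>- \<alpha>\<close> is nonnegative too and the two coincide.\<close>

lemma abs_eq_self_iff: "\<bar>\<alpha>\<bar>\<^sub>F = \<alpha> \<longleftrightarrow> 0 \<preceq> \<alpha>"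
  by (metis abs_nonneg abs_cases nonneg_and_uminus_nonneg)

lemma abs_eq_zero_iff: "\<bar>\<alpha>\<bar>\<^sub>F = 0 \<longleftrightarrow> \<alpha> = 0"
  by (metis abs_cases abs_eq_self_iff le_refl tri_uminus_uminus tri_uminus_zero)

text \<open>Lets a proof start from a nonnegative element, where the absolute value is the identity;
  evenness then carries the result to its opposite.\<close>

lemma nonneg_cases [case_names nonneg uminus]:
  assumes "\<And>\<alpha>. 0 \<preceq> \<alpha> \<Longrightarrow> P \<alpha>" "\<And>\<alpha>. 0 \<preceq> \<alpha> \<Longrightarrow> P (- \<alpha>)"
  shows "P \<alpha>"
  using assms nonneg_or_uminus_nonneg[of \<alpha>] by (metis tri_uminus_uminus)

lemma abs_scaleR_nonneg:
  assumes "0 \<le> t"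
  shows "\<bar>t *\<^sub>R \<alpha>\<bar>\<^sub>F = t *\<^sub>R \<bar>\<alpha>\<bar>\<^sub>F"
proof (induction \<alpha> rule: nonneg_cases)
  case (nonneg \<alpha>)
  then show ?case
    using assms nonneg_scaleR abs_eq_self_iff by metis
next
  case (uminus \<alpha>)
  then have "\<bar>t *\<^sub>R \<alpha>\<bar>\<^sub>F = t *\<^sub>R \<bar>\<alpha>\<bar>\<^sub>F"
    using assms nonneg_scaleR abs_eq_self_iff by metis
  moreover have "t *\<^sub>R (- \<alpha>) = - (t *\<^sub>R \<alpha>)"
    by (simp add: tri_scaleR_uminus tri_uminus_scaleR)
  ultimately show ?case
    by simp
qed

lemma abs_scaleR: "\<bar>t *\<^sub>R \<alpha>\<bar>\<^sub>F = \<bar>t\<bar> *\<^sub>R \<bar>\<alpha>\<bar>\<^sub>F"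
proof (cases "0 \<le> t")
  case False
  \<comment> \<open>The sign of \<open>t\<close> moves onto \<alpha>, where the absolute value
    ignores it.\<close>
  then have "t *\<^sub>R \<alpha> = \<bar>t\<bar> *\<^sub>R (- \<alpha>)"
    by (simp add: tri_scaleR_uminus)
  then show ?thesis
    by (simp add: abs_scaleR_nonneg)
qed (simp add: abs_scaleR_nonneg)

text \<open>Negation distributes over addition, so both candidates for the maximum are bounded
  summand by summand.\<close>

lemma abs_triangle: "\<bar>\<alpha> + \<beta>\<bar>\<^sub>F \<preceq> \<bar>\<alpha>\<bar>\<^sub>F + \<bar>\<beta>\<bar>\<^sub>F"
  by (rule abs_leI) (simp_all add: tri_uminus_add le_add_mono le_abs uminus_le_abs)

text \<open>Adding \<sigma> keeps nonnegative elements nonnegative and commutes with negation, so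
  the choice between an element and its opposite is unaffected.\<close>

lemma abs_add_symmetric:
  assumes "- \<sigma> = \<sigma>"
  shows "\<bar>\<alpha> + \<sigma>\<bar>\<^sub>F = \<bar>\<alpha>\<bar>\<^sub>F + \<sigma>"
proof -
  have *: "\<bar>\<alpha> + \<sigma>\<bar>\<^sub>F = \<bar>\<alpha>\<bar>\<^sub>F + \<sigma>" if "0 \<preceq> \<alpha>" for \<alpha>
    using that assms abs_eq_self_iff le_add_nonneg nonneg_if_uminus_eq le_trans by metis
  show ?thesis
  proof (induction \<alpha> rule: nonneg_cases)
    case (uminus \<alpha>)
    have "- \<alpha> + \<sigma> = - (\<alpha> + \<sigma>)"
      using assms by (simp add: tri_uminus_add)
    then show ?case
      using *[OF uminus] by simp
  qed (rule *)
qed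

lemma abs_triangle_minus: "\<bar>\<alpha> - \<gamma>\<bar>\<^sub>F \<preceq> \<bar>\<alpha> - \<beta>\<bar>\<^sub>F + \<bar>\<beta> - \<gamma>\<bar>\<^sub>F"
proof -
  have "\<bar>\<alpha> - \<gamma>\<bar>\<^sub>F \<preceq> \<bar>\<alpha> - \<gamma>\<bar>\<^sub>F + (\<beta> - \<beta>)"
    by (simp add: le_add_nonneg nonneg_minus_self)
  \<comment> \<open>The middle terms do not cancel: they leave the symmetric number
    \<open>\<beta> - \<beta>\<close>, which may pass in and out of the absolute value.\<close>
  also have "\<bar>\<alpha> - \<gamma>\<bar>\<^sub>F + (\<beta> - \<beta>) = \<bar>(\<alpha> - \<beta>) + (\<beta> - \<gamma>)\<bar>\<^sub>F"
    using abs_add_symmetric[of "\<beta> - \<beta>" "\<alpha> - \<gamma>"]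
    by (simp add: tri_uminus_minus) (simp add: tri_minus_eq ac_simps)
  also have "\<dots> \<preceq> \<bar>\<alpha> - \<beta>\<bar>\<^sub>F + \<bar>\<beta> - \<gamma>\<bar>\<^sub>F"
    by (rule abs_triangle)
  finally show ?thesis .
qed

lemma abs_minus_self: "\<bar>\<beta>\<bar>\<^sub>F - \<bar>\<beta>\<bar>\<^sub>F = \<beta> - \<beta>"
  using abs_cases[of \<beta>] by (auto simp: tri_minus_eq add.commute)

lemma abs_minus_commute: "\<bar>\<alpha> - \<beta>\<bar>\<^sub>F = \<bar>\<beta> - \<alpha>\<bar>\<^sub>F"
  by (metis abs_uminus tri_uminus_minus)

text \<open>The absolute value of \<beta> is added to both sides and cancelled afterwards; the
  leftover difference with itself equals \<open>\<beta> - \<beta>\<close> and is absorbed.\<close>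

lemma abs_minus_abs_le: "\<bar>\<alpha>\<bar>\<^sub>F - \<bar>\<beta>\<bar>\<^sub>F \<preceq> \<bar>\<alpha> - \<beta>\<bar>\<^sub>F"
proof (rule le_add_right_cancel)
  have "\<bar>\<alpha>\<bar>\<^sub>F - \<bar>\<beta>\<bar>\<^sub>F + \<bar>\<beta>\<bar>\<^sub>F = \<bar>\<alpha>\<bar>\<^sub>F + (\<bar>\<beta>\<bar>\<^sub>F - \<bar>\<beta>\<bar>\<^sub>F)"
    by (simp add: tri_minus_eq ac_simps)
  also have "\<dots> = \<bar>\<alpha> + (\<beta> - \<beta>)\<bar>\<^sub>F"
    by (simp add: abs_minus_self abs_add_symmetric tri_uminus_minus)
  also have "\<dots> = \<bar>(\<alpha> - \<beta>) + \<beta>\<bar>\<^sub>F"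
    by (simp add: tri_minus_eq ac_simps)
  also have "\<dots> \<preceq> \<bar>\<alpha> - \<beta>\<bar>\<^sub>F + \<bar>\<beta>\<bar>\<^sub>F"
    by (rule abs_triangle)
  finally show "\<bar>\<alpha>\<bar>\<^sub>F - \<bar>\<beta>\<bar>\<^sub>F + \<bar>\<beta>\<bar>\<^sub>F \<preceq> \<bar>\<alpha> - \<beta>\<bar>\<^sub>F + \<bar>\<beta>\<bar>\<^sub>F" .
qed

text \<open>Exchanging \<alpha> and \<beta> bounds the opposite difference as well.\<close>

lemma abs_abs_minus_abs_le: "\<bar>\<bar>\<alpha>\<bar>\<^sub>F - \<bar>\<beta>\<bar>\<^sub>F\<bar>\<^sub>F \<preceq> \<bar>\<alpha> - \<beta>\<bar>\<^sub>F"
  by (rule abs_leI) (metis abs_minus_abs_le abs_minus_commute tri_uminus_minus)+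

text \<open>Homogeneity reduces this to \<open>scalar 1\<close>, whose sign the premise fixes; for
  the reversed order on scalars the value would be \<open>scalar (- \<bar>t\<bar>)\<close>.\<close>

lemma abs_scalar: "0 \<preceq> scalar 1 \<Longrightarrow> \<bar>scalar t\<bar>\<^sub>F = scalar \<bar>t\<bar>"
  by (metis abs_eq_self_iff abs_scaleR scalar_eq_scaleR)

end

theorem theorem28:
  fixes le :: "tri_fuzzy \<Rightarrow> tri_fuzzy \<Rightarrow> bool"  (infix "\<preceq>" 50)
  assumes "total_order (\<preceq>)"
    and "arith_compatible (\<preceq>)"
    and "weak_trichotomy (\<preceq>)"
    and "has_positive_zero_symmetric (\<preceq>)"
  shows "induces_fuzzy_abs (\<preceq>) \<and>
    (\<forall>\<alpha> \<beta> \<gamma>.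
      (fuzzy_abs (\<preceq>) \<alpha> = \<alpha> \<longleftrightarrow> 0 \<preceq> \<alpha>) \<and>
      (fuzzy_abs (\<preceq>) \<alpha> = 0 \<longleftrightarrow> \<alpha> = 0) \<and>
      (\<forall>t. fuzzy_abs (\<preceq>) (t *\<^sub>R \<alpha>) = \<bar>t\<bar> *\<^sub>R fuzzy_abs (\<preceq>) \<alpha>) \<and>
      fuzzy_abs (\<preceq>) (\<alpha> + \<beta>) \<preceq> fuzzy_abs (\<preceq>) \<alpha> + fuzzy_abs (\<preceq>) \<beta> \<and>
      fuzzy_abs (\<preceq>) (\<alpha> - \<gamma>) \<preceq> fuzzy_abs (\<preceq>) (\<alpha> - \<beta>) + fuzzy_abs (\<preceq>) (\<beta> - \<gamma>) \<and>
      fuzzy_abs (\<preceq>) (fuzzy_abs (\<preceq>) \<alpha> - fuzzy_abs (\<preceq>) \<beta>) \<preceq> fuzzy_abs (\<preceq>) (\<alpha> - \<beta>)) \<and>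
    (0 \<preceq> scalar 1 \<longrightarrow> (\<forall>t. fuzzy_abs (\<preceq>) (scalar t) = scalar \<bar>t\<bar>))"
proof -
  interpret compatible_fuzzy_order "(\<preceq>)"
    using assms by unfold_locales
  show ?thesis
    unfolding induces_fuzzy_abs_def
    by (simp only: abs_nonneg abs_scaleR abs_triangle abs_triangle_minus abs_eq_self_iff
        abs_eq_zero_iff abs_abs_minus_abs_le simp_thms) (blast intro: abs_scalar)
qed

end
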